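(* Let $l\le k$ be nonnegative integers and let $\tau\in B_l$. Let $P=\tau\,k(k-1)\ldots(l+1)\in B_k$ and $Q=\bar{\tau}\,k(k-1)\ldots(l+1)\in B_k$. Then $|B_n(P)|=|B_n(Q)|$ and $|SI_n(P)|=|SI_n(Q)|$ for all $n\ge 1$.
   Context: $B_n$ is the set of signed permutations of $[n]$, written as words $\pi=\pi_1\cdots\pi_n$ in which each of $1,\dots,n$ appears exactly once, possibly barred (negative). $|\pi_i|$ is the unsigned value; $\bar{\pi}$ is obtained by changing the sign of every entry. A signed permutation $\pi\in B_n$ contains $\tau\in B_k$ if there are indices $i_1<\dots<i_k$ such that for all $a,b$: $|\pi_{i_a}|<|\pi_{i_b}|$ iff $|\tau_a|<|\tau_b|$, and $\pi_{i_a}$ is positive iff $\tau_a$ is positive; otherwise $\pi$ avoids $\tau$. $M(\tau)$ is the set of elements of $M$ avoiding $\tau$. $SI_n$ is the set of signed involutions in $B_n$ (signed permutations $\pi$, viewed as bijections of $\{\pm1,\dots,\pm n\}$ with $\pi(-i)=-\pi(i)$, satisfying $\pi\circ\pi=\mathrm{id}$). The word $\tau\,k(k-1)\ldots(l+1)$ is the concatenation of $\tau$ (on values $1,\dots,l$) with the unbarred letters $k,k-1,\dots,l+1$ in decreasing order. *)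

theory Defs
  imports Main
begin

text \<open>Signed permutations of \<open>[n]\<close> are words over the nonzero integers; a barred letter is a
  negative integer. List positions are counted from 0.\<close>

definition signed_perms :: "nat \<Rightarrow> int list set" where
  "signed_perms n = {w. length w = n \<and> distinct (map abs w) \<and> set (map abs w) = {1..int n}}"

definition bar :: "int list \<Rightarrow> int list" where
  "bar w = map uminus w"

definition contains :: "int list \<Rightarrow> int list \<Rightarrow> bool" where
  "contains w t \<longleftrightarrow> (\<exists>idx :: nat \<Rightarrow> nat.
     strict_mono_on {..<length t} idx \<and>
     (\<forall>a<length t. idx a < length w) \<and>
     (\<forall>a<length t. \<forall>b<length t.
        \<bar>w ! idx a\<bar> < \<bar>w ! idx b\<bar> \<longleftrightarrow> \<bar>t ! a\<bar> < \<bar>t ! b\<bar>) \<and>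
     (\<forall>a<length t. w ! idx a > 0 \<longleftrightarrow> t ! a > 0))"

definition avoiding :: "int list set \<Rightarrow> int list \<Rightarrow> int list set" where
  "avoiding M t = {w \<in> M. \<not> contains w t}"

text \<open>The map on \<open>{\<plusminus>1, \<dots>, \<plusminus>n}\<close> given by a word: \<open>i \<mapsto> w\<^sub>i\<close> for \<open>i > 0\<close>, extended as an
  odd function.\<close>

definition signed_fun :: "int list \<Rightarrow> int \<Rightarrow> int" where
  "signed_fun w i = sgn i * w ! (nat \<bar>i\<bar> - 1)"

definition signed_involutions :: "nat \<Rightarrow> int list set" where
  "signed_involutions n = {w \<in> signed_perms n.
     \<forall>i. i \<noteq> 0 \<and> \<bar>i\<bar> \<le> int n \<longrightarrow> signed_fun w (signed_fun w i) = i}"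

lemma finite_signed_perms: "finite (signed_perms n)"
proof (rule finite_subset)
  show "signed_perms n \<subseteq> {w. set w \<subseteq> {- int n..int n} \<and> length w = n}"
  proof
    fix w assume w: "w \<in> signed_perms n"
    have "x \<in> {- int n..int n}" if "x \<in> set w" for x
    proof -
      have "\<bar>x\<bar> \<in> {1..int n}" using w that unfolding signed_perms_def by auto
      then show ?thesis by auto
    qed
    then show "w \<in> {w. set w \<subseteq> {- int n..int n} \<and> length w = n}"
      using w unfolding signed_perms_def by auto
  qed
  show "finite {w. set w \<subseteq> {- int n..int n} \<and> length w = n}"
    by (rule finite_lists_length_eq) simp
qed

lemma bar_signed_perms: "t \<in> signed_perms l \<Longrightarrow> bar t \<in> signed_perms l"
  by (simp add: signed_perms_def bar_def image_image comp_def)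

lemma append_decreasing_signed_perms:
  assumes "l \<le> k" "t \<in> signed_perms l"
  shows "t @ rev [int l + 1..int k] \<in> signed_perms k"
proof -
  have *: "map abs [int l + 1..int k] = [int l + 1..int k]"
    by (rule map_idI) auto
  have t: "length t = l" "distinct (map abs t)" "set (map abs t) = {1..int l}"
    using assms(2) unfolding signed_perms_def by auto
  have m: "map abs (t @ rev [int l + 1..int k]) = map abs t @ rev [int l + 1..int k]"
    using * by (simp flip: rev_map)
  have d: "distinct (map abs t @ rev [int l + 1..int k])"
    using t(2,3) unfolding distinct_append by auto
  have s: "set (map abs t @ rev [int l + 1..int k]) = {1..int k}"
    unfolding set_append t(3) using assms(1) by auto
  show ?thesis
    unfolding signed_perms_def mem_Collect_eq m using d s t(1) assms(1) by simp
qed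

end

theory Submission
  imports Defs
begin

text \<open>Call an entry of \<open>w\<close> low if strictly to the right of it and strictly above its absolute value
  there is a decreasing sequence of \<open>m = k - l\<close> positive entries. In an occurrence of \<open>P\<close>, the part
  that matches \<open>\<tau>\<close> consists of low entries, and the decreasing part can be pushed to the right until
  none of its entries is low. Changing the sign of all low entries therefore does not change which
  entries are low; it is an involution on signed permutations that exchanges the occurrences of
  \<open>\<tau>\<close> and \<open>bar \<tau>\<close> extended by the decreasing sequence. The notion of a low entry is symmetric under
  transposing the permutation matrix, so this involution preserves signed involutions.\<close>

section \<open>Low entries and the sign flip\<close>

definition decreasing_at :: "int list \<Rightarrow> nat set \<Rightarrow> bool" where
  "decreasing_at w S \<longleftrightarrow> S \<subseteq> {..<length w} \<and> (\<forall>p\<in>S. w ! p > 0) \<and>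
     (\<forall>p\<in>S. \<forall>q\<in>S. p < q \<longrightarrow> w ! q < w ! p)"

text \<open>For \<open>m = 0\<close> the empty set is a witness, so every entry is low and
  \<open>flip_low\<close> is \<open>bar\<close>. This is how the case \<open>k = l\<close> is
  covered.\<close>

definition low :: "nat \<Rightarrow> int list \<Rightarrow> nat \<Rightarrow> bool" where
  "low m w i \<longleftrightarrow> (\<exists>S. decreasing_at w S \<and> card S = m \<and> (\<forall>p\<in>S. i < p \<and> \<bar>w ! i\<bar> < w ! p))"

definition flip_low :: "nat \<Rightarrow> int list \<Rightarrow> int list" where
  "flip_low m w = map (\<lambda>i. if low m w i then - w ! i else w ! i) [0..<length w]"

lemma length_flip_low [simp]: "length (flip_low m w) = length w"
  by (simp add: flip_low_def)

lemma nth_flip_low: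
  "i < length w \<Longrightarrow> flip_low m w ! i = (if low m w i then - w ! i else w ! i)"
  by (simp add: flip_low_def)

lemma abs_nth_flip_low [simp]: "i < length w \<Longrightarrow> \<bar>flip_low m w ! i\<bar> = \<bar>w ! i\<bar>"
  by (simp add: nth_flip_low)

lemma decreasing_at_finite: "decreasing_at w S \<Longrightarrow> finite S"
  unfolding decreasing_at_def using finite_subset by blast

lemma decreasing_at_cong:
  assumes "decreasing_at w S" "length v = length w" "\<And>p. p \<in> S \<Longrightarrow> v ! p = w ! p"
  shows "decreasing_at v S"
  using assms unfolding decreasing_at_def by simp

text \<open>If some entry of \<open>S\<close> is low, its witness is a sequence with a larger leftmost position that
  still lies beyond every cell \<open>(i, c)\<close> below and to the left of \<open>S\<close>.\<close>

lemma exists_decreasing_at_not_low: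
  assumes "decreasing_at w S" "card S = m"
  obtains T where "decreasing_at w T" "card T = m" "\<And>p. p \<in> T \<Longrightarrow> \<not> low m w p"
    "\<And>i c. (\<forall>p\<in>S. i < p \<and> c < w ! p) \<Longrightarrow> (\<forall>p\<in>T. i < p \<and> c < w ! p)"
proof -
  have "\<exists>T. decreasing_at w T \<and> card T = m \<and> (\<forall>p\<in>T. \<not> low m w p) \<and>
      (\<forall>i c. (\<forall>p\<in>S. i < p \<and> c < w ! p) \<longrightarrow> (\<forall>p\<in>T. i < p \<and> c < w ! p))"
    using assms
  \<comment> \<open>Each replacement moves the leftmost position to the right, and positions stay
    below \<open>length w\<close>, so the measure drops. If \<open>S\<close> is empty, where
    \<open>Min S\<close> is unspecified, the case without low entries closes the goal at
    once.\<close>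
  proof (induction "length w - Min S" arbitrary: S rule: less_induct)
    case less
    show ?case
    proof (cases "\<exists>x\<in>S. low m w x")
      case False
      with less.prems show ?thesis by blast
    next
      case True
      then obtain x U where x: "x \<in> S" and U: "decreasing_at w U" "card U = m"
        "\<forall>p\<in>U. x < p \<and> \<bar>w ! x\<bar> < w ! p"
        unfolding low_def by blast
      have fin: "finite S" "finite U"
        using less.prems(1) U(1) decreasing_at_finite by auto
      have "card S > 0" using fin(1) x card_gt_0_iff by blast
      then have "U \<noteq> {}" using less.prems(2) U(2) by auto
      then have MinU: "Min U \<in> U" using fin(2) by simp
      then have "Min U < length w" using U(1) unfolding decreasing_at_def by auto
      moreover have "Min S < Min U"
        using U(3) MinU Min_le[OF fin(1) x] by fastforce
      ultimately have "length w - Min U < length w - Min S" by simp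
      from less.hyps[OF this U(1,2)] obtain T where
        T: "decreasing_at w T" "card T = m" "\<forall>p\<in>T. \<not> low m w p"
        "\<forall>i c. (\<forall>p\<in>U. i < p \<and> c < w ! p) \<longrightarrow> (\<forall>p\<in>T. i < p \<and> c < w ! p)"
        by blast
      \<comment> \<open>A cell below and to the left of all of \<open>S\<close> is so for the entry
        at \<open>x\<close> in particular, and that entry lies below and to the left of
        \<open>U\<close>.\<close>
      have "\<forall>p\<in>U. i < p \<and> c < w ! p" if "\<forall>p\<in>S. i < p \<and> c < w ! p" for i c
        using that x U(3) by fastforce
      with T show ?thesis by blast
    qed
  qed
  then show ?thesis using that by blast
qed

text \<open>A witness for a low entry can be chosen free of low entries. The flip leaves such a
  witness untouched, and lowness depends on the tested entry only through its position and absolute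
  value.\<close>

lemma low_flip_low:
  assumes i: "i < length w"
  shows "low m (flip_low m w) i \<longleftrightarrow> low m w i"
proof -
  have fwd: "low m (flip_low m w) j" if j: "low m w j" "j < length w" for j
  proof -
    from j(1) obtain S where S: "decreasing_at w S" "card S = m"
      "\<forall>p\<in>S. j < p \<and> \<bar>w ! j\<bar> < w ! p" unfolding low_def by blast
    obtain T where T: "decreasing_at w T" "card T = m" "\<And>p. p \<in> T \<Longrightarrow> \<not> low m w p"
      "\<And>i c. (\<forall>p\<in>S. i < p \<and> c < w ! p) \<Longrightarrow> (\<forall>p\<in>T. i < p \<and> c < w ! p)"
      by (rule exists_decreasing_at_not_low[OF S(1,2)]) blast
    have eq: "flip_low m w ! p = w ! p" if "p \<in> T" for p
      using T(1,3) that unfolding decreasing_at_def by (auto simp: nth_flip_low)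
    have "decreasing_at (flip_low m w) T"
      by (rule decreasing_at_cong[OF T(1)]) (simp_all add: eq)
    then show ?thesis
      unfolding low_def using T(2) T(4)[OF S(3)] eq j(2) by auto
  qed
  show ?thesis
  proof
    assume "low m (flip_low m w) i"
    then obtain S where S: "decreasing_at (flip_low m w) S" "card S = m"
      "\<forall>p\<in>S. i < p \<and> \<bar>flip_low m w ! i\<bar> < flip_low m w ! p" unfolding low_def by blast
    obtain T where T: "decreasing_at (flip_low m w) T" "card T = m"
      "\<And>p. p \<in> T \<Longrightarrow> \<not> low m (flip_low m w) p"
      "\<And>i c. (\<forall>p\<in>S. i < p \<and> c < flip_low m w ! p) \<Longrightarrow> (\<forall>p\<in>T. i < p \<and> c < flip_low m w ! p)"
      by (rule exists_decreasing_at_not_low[OF S(1,2)]) blast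
    \<comment> \<open>Here \<open>T\<close> is free of entries that are low in the flipped word. By
      \<open>fwd\<close> these entries are not low in \<open>w\<close> either, so the flip did not
      change them.\<close>
    have eq: "flip_low m w ! p = w ! p" if "p \<in> T" for p
    proof -
      have "p < length w" using T(1) that unfolding decreasing_at_def by auto
      then show ?thesis using T(3)[OF that] fwd nth_flip_low by auto
    qed
    have "decreasing_at w T"
      by (rule decreasing_at_cong[OF T(1)]) (simp_all add: eq)
    then show "low m w i"
      unfolding low_def using T(2) T(4)[OF S(3)] eq i by auto
  qed (use fwd i in blast)
qed

lemma flip_low_flip_low [simp]: "flip_low m (flip_low m w) = w"
  by (rule nth_equalityI) (auto simp: nth_flip_low low_flip_low)

lemma map_abs_flip_low: "map abs (flip_low m w) = map abs w"
  by (rule nth_equalityI) simp_all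

lemma flip_low_signed_perms: "w \<in> signed_perms n \<Longrightarrow> flip_low m w \<in> signed_perms n"
  unfolding signed_perms_def mem_Collect_eq map_abs_flip_low by simp

section \<open>Signed involutions and reflection in the diagonal\<close>

lemma signed_perms_nth:
  assumes "w \<in> signed_perms n" "p < n"
  shows "1 \<le> \<bar>w ! p\<bar>" "\<bar>w ! p\<bar> \<le> int n"
proof -
  have "\<bar>w ! p\<bar> \<in> set (map abs w)"
    using assms unfolding signed_perms_def by auto
  then have "\<bar>w ! p\<bar> \<in> {1..int n}"
    using assms unfolding signed_perms_def by auto
  then show "1 \<le> \<bar>w ! p\<bar>" "\<bar>w ! p\<bar> \<le> int n" by auto
qed

text \<open>Since \<open>signed_fun w\<close> is odd, positive arguments suffice. Position
  \<open>p\<close>, counted from 0, stands for the argument \<open>p + 1\<close>.\<close>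

lemma signed_involutions_iff:
  "w \<in> signed_involutions n \<longleftrightarrow> w \<in> signed_perms n \<and>
    (\<forall>p<n. sgn (w ! p) * w ! (nat \<bar>w ! p\<bar> - 1) = int p + 1)" (is "_ \<longleftrightarrow> _ \<and> ?R")
proof (cases "w \<in> signed_perms n")
  case True
  have odd: "signed_fun w (- x) = - signed_fun w x" for x
    by (simp add: signed_fun_def)
  have succ: "signed_fun w (signed_fun w (int p + 1)) = sgn (w ! p) * w ! (nat \<bar>w ! p\<bar> - 1)" for p
    by (simp add: signed_fun_def nat_add_distrib)
  have "(\<forall>i. i \<noteq> 0 \<and> \<bar>i\<bar> \<le> int n \<longrightarrow> signed_fun w (signed_fun w i) = i) \<longleftrightarrow> ?R"
  proof
    assume L: "\<forall>i. i \<noteq> 0 \<and> \<bar>i\<bar> \<le> int n \<longrightarrow> signed_fun w (signed_fun w i) = i"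
    show ?R
    proof (intro allI impI)
      fix p assume "p < n"
      then show "sgn (w ! p) * w ! (nat \<bar>w ! p\<bar> - 1) = int p + 1"
        using L[rule_format, of "int p + 1"] by (simp add: succ)
    qed
  next
    assume R: ?R
    show "\<forall>i. i \<noteq> 0 \<and> \<bar>i\<bar> \<le> int n \<longrightarrow> signed_fun w (signed_fun w i) = i"
    proof (intro allI impI)
      fix i :: int assume i: "i \<noteq> 0 \<and> \<bar>i\<bar> \<le> int n"
      define p where "p = nat \<bar>i\<bar> - 1"
      have p: "p < n" "\<bar>i\<bar> = int p + 1" using i unfolding p_def by auto
      have *: "signed_fun w (signed_fun w (int p + 1)) = int p + 1"
        using R p(1) by (simp add: succ)
      consider "i = int p + 1" | "i = - (int p + 1)" using p(2) by linarith
      then show "signed_fun w (signed_fun w i) = i"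
        using * by cases (simp_all only: odd)
    qed
  qed
  then show ?thesis using True by (simp add: signed_involutions_def)
qed (simp add: signed_involutions_def)

text \<open>The plot of absolute values of a signed involution is symmetric in the diagonal, and
  mirror images carry the same sign. Reflection preserves both decreasing sequences and the relation
  of lying strictly above and to the right, so it carries a witness for an entry to a witness for
  its mirror image.\<close>

lemma low_signed_involution:
  assumes w: "w \<in> signed_involutions n" and p: "p < n" and low: "low m w p"
  shows "low m w (nat \<bar>w ! p\<bar> - 1)"
proof -
  \<comment> \<open>\<open>f s\<close> is the position of the mirror image of the entry at
    \<open>s\<close>; the 1 is subtracted because positions count from 0.\<close>
  define f where "f = (\<lambda>s. nat \<bar>w ! s\<bar> - 1)"
  have sp: "w \<in> signed_perms n" and inv: "\<And>s. s < n \<Longrightarrow> sgn (w ! s) * w ! f s = int s + 1"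
    using w unfolding signed_involutions_iff f_def by auto
  have len: "length w = n" using sp unfolding signed_perms_def by simp
  have f: "f s < n" "int (f s) = \<bar>w ! s\<bar> - 1" if "s < n" for s
    using signed_perms_nth[OF sp that] unfolding f_def by auto
  have abs_f: "\<bar>w ! f s\<bar> = int s + 1" if "s < n" for s
  proof -
    have "\<bar>sgn (w ! s) * w ! f s\<bar> = int s + 1" using inv[OF that] by simp
    moreover have "w ! s \<noteq> 0" using signed_perms_nth(1)[OF sp that] by auto
    ultimately show ?thesis by (simp add: abs_mult)
  qed
  from low obtain S where S: "decreasing_at w S" "card S = m"
    "\<forall>s\<in>S. p < s \<and> \<bar>w ! p\<bar> < w ! s" unfolding low_def by blast
  have Sn: "s < n" and Spos: "w ! s > 0" if "s \<in> S" for s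
    using S(1) that len unfolding decreasing_at_def by auto
  have wf: "w ! f s = int s + 1" if "s \<in> S" for s
    using inv[OF Sn[OF that]] Spos[OF that] by simp
  have fS: "int (f s) = w ! s - 1" if "s \<in> S" for s
    using f(2)[OF Sn[OF that]] Spos[OF that] by simp
  have "inj_on f S"
    using wf by (metis (mono_tags, lifting) add_right_cancel inj_onI of_nat_eq_iff)
  then have "card (f ` S) = m" using S(2) by (simp add: card_image)
  moreover have "decreasing_at w (f ` S)"
    unfolding decreasing_at_def
  proof (intro conjI ballI impI)
    show "f ` S \<subseteq> {..<length w}" using f(1) Sn len by auto
    show "0 < w ! q" if "q \<in> f ` S" for q
      using that wf by auto
    fix q r assume "q \<in> f ` S" "r \<in> f ` S" and qr: "q < r"
    then obtain s t where st: "s \<in> S" "t \<in> S" "q = f s" "r = f t" by auto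
    \<comment> \<open>Positions and values trade places: \<open>q < r\<close> compares the values at
      \<open>s\<close> and \<open>t\<close>, which forces \<open>t < s\<close>, and this in turn
      compares the values at \<open>r\<close> and \<open>q\<close>.\<close>
    then have "w ! s < w ! t" using qr fS[of s] fS[of t] by simp
    then have "t < s"
      using S(1) st(1,2) unfolding decreasing_at_def by (metis less_asym linorder_neqE_nat)
    then show "w ! r < w ! q" using st wf by simp
  qed
  moreover have "\<forall>q\<in>f ` S. f p < q \<and> \<bar>w ! f p\<bar> < w ! q"
  proof
    fix q assume "q \<in> f ` S"
    then obtain s where s: "s \<in> S" "q = f s" by auto
    have "int (f p) < int (f s)"
      using S(3) s fS f(2)[OF p] by simp
    moreover have "\<bar>w ! f p\<bar> < w ! f s"
      using S(3) s wf[OF s(1)] abs_f[OF p] by auto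
    ultimately show "f p < q \<and> \<bar>w ! f p\<bar> < w ! q" using s by simp
  qed
  ultimately show ?thesis unfolding low_def f_def by blast
qed

text \<open>An entry and its mirror image are low together, so in each product of the involution
  condition either both factors change sign or neither does.\<close>

lemma flip_low_signed_involutions:
  assumes w: "w \<in> signed_involutions n"
  shows "flip_low m w \<in> signed_involutions n"
  unfolding signed_involutions_iff
proof (intro conjI allI impI)
  have sp: "w \<in> signed_perms n" using w by (simp add: signed_involutions_iff)
  then show "flip_low m w \<in> signed_perms n" by (rule flip_low_signed_perms)
  have len: "length w = n" using sp unfolding signed_perms_def by simp
  fix p assume p: "p < n"
  define q where "q = nat \<bar>w ! p\<bar> - 1"
  have inv: "sgn (w ! p) * w ! q = int p + 1"
    using w p unfolding signed_involutions_iff q_def by simp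
  have q: "q < n" using signed_perms_nth[OF sp p] unfolding q_def by auto
  have "w ! p \<noteq> 0" using signed_perms_nth(1)[OF sp p] by auto
  then have "\<bar>w ! q\<bar> = int p + 1"
    using arg_cong[OF inv, of abs] by (simp add: abs_mult)
  then have "nat \<bar>w ! q\<bar> - 1 = p" by simp
  \<comment> \<open>The mirror image of \<open>q\<close> is \<open>p\<close> again, so the one-sided
    lemma applied at \<open>p\<close> and at \<open>q\<close> gives both directions.\<close>
  then have "low m w q \<longleftrightarrow> low m w p"
    using low_signed_involution[OF w p, folded q_def] low_signed_involution[OF w q] by auto
  then have "sgn (flip_low m w ! p) * flip_low m w ! q = int p + 1"
    using inv p q len by (simp add: nth_flip_low)
  then show "sgn (flip_low m w ! p) * flip_low m w ! (nat \<bar>flip_low m w ! p\<bar> - 1) = int p + 1"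
    using p len by (simp add: q_def)
qed

section \<open>Occurrences of a pattern with a decreasing tail\<close>

text \<open>The body of \<open>contains\<close> with its embedding exposed, so that the embedding of
  \<tau> can be kept while the positions of the tail are exchanged.\<close>

definition occurrence :: "int list \<Rightarrow> int list \<Rightarrow> (nat \<Rightarrow> nat) \<Rightarrow> bool" where
  "occurrence w t idx \<longleftrightarrow> strict_mono_on {..<length t} idx \<and>
     (\<forall>a<length t. idx a < length w) \<and>
     (\<forall>a<length t. \<forall>b<length t. \<bar>w ! idx a\<bar> < \<bar>w ! idx b\<bar> \<longleftrightarrow> \<bar>t ! a\<bar> < \<bar>t ! b\<bar>) \<and>
     (\<forall>a<length t. w ! idx a > 0 \<longleftrightarrow> t ! a > 0)"

lemma contains_append_decreasing_iff:
  assumes t: "t \<in> signed_perms l" and lk: "l \<le> k"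
  shows "contains w (t @ rev [int l + 1..int k]) \<longleftrightarrow>
    (\<exists>idx S. occurrence w t idx \<and> decreasing_at w S \<and> card S = k - l \<and>
       (\<forall>a<l. \<forall>p\<in>S. idx a < p \<and> \<bar>w ! idx a\<bar> < w ! p))" (is "contains w ?P \<longleftrightarrow> ?R")
proof -
  have len: "length t = l" using t unfolding signed_perms_def by simp
  have lenP: "length ?P = k" using len lk by simp
  have P1: "?P ! a = t ! a" if "a < l" for a
    using that len by (simp add: nth_append)
  \<comment> \<open>The tail starts with \<open>k\<close> at position \<open>l\<close> and ends with
    \<open>l + 1\<close> at position \<open>k - 1\<close>.\<close>
  have P2: "?P ! a = int (k + l - a)" if "l \<le> a" "a < k" for a
    using that len by (simp add: nth_append rev_nth)
  have t_le: "\<bar>t ! a\<bar> \<le> int l" if "a < l" for a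
    using signed_perms_nth[OF t that] by simp
  show ?thesis
  proof
    assume "contains w ?P"
    then obtain idx where mono: "strict_mono_on {..<k} idx" and lt: "\<forall>a<k. idx a < length w"
      and ord: "\<forall>a<k. \<forall>b<k. \<bar>w ! idx a\<bar> < \<bar>w ! idx b\<bar> \<longleftrightarrow> \<bar>?P ! a\<bar> < \<bar>?P ! b\<bar>"
      and pos: "\<forall>a<k. w ! idx a > 0 \<longleftrightarrow> ?P ! a > 0"
      unfolding contains_def lenP by blast
    have inc: "idx a < idx b \<longleftrightarrow> a < b" if "a < k" "b < k" for a b
      using strict_mono_on_less[OF mono] that by simp
    have pos': "w ! idx a > 0" if "l \<le> a" "a < k" for a
      using pos that P2[OF that] by simp
    have "strict_mono_on {..<l} idx"
      using mono lk by (auto simp: strict_mono_on_def)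
    then have "occurrence w t idx"
      unfolding occurrence_def len using lt ord pos lk P1 by auto
    moreover have "card (idx ` {l..<k}) = k - l"
    proof -
      have "inj_on idx {l..<k}"
        by (rule inj_on_subset[OF strict_mono_on_imp_inj_on[OF mono]]) auto
      then show ?thesis by (simp add: card_image)
    qed
    moreover have "decreasing_at w (idx ` {l..<k})"
      unfolding decreasing_at_def
    proof (intro conjI ballI impI)
      show "idx ` {l..<k} \<subseteq> {..<length w}" using lt by auto
      show "0 < w ! p" if "p \<in> idx ` {l..<k}" for p using that pos' by auto
      fix p q assume "p \<in> idx ` {l..<k}" "q \<in> idx ` {l..<k}" and pq: "p < q"
      then obtain a b where ab: "l \<le> a" "a < k" "l \<le> b" "b < k" "p = idx a" "q = idx b" by auto
      then have "a < b" using inc pq by simp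
      then have "\<bar>?P ! b\<bar> < \<bar>?P ! a\<bar>" using ab P2 by simp
      then have "\<bar>w ! q\<bar> < \<bar>w ! p\<bar>" using ord ab by blast
      then show "w ! q < w ! p" using pos'[OF ab(1,2)] pos'[OF ab(3,4)] ab(5,6) by simp
    qed
    moreover have "\<forall>a<l. \<forall>p\<in>idx ` {l..<k}. idx a < p \<and> \<bar>w ! idx a\<bar> < w ! p"
    proof (intro allI impI ballI)
      fix a p assume a: "a < l" and "p \<in> idx ` {l..<k}"
      then obtain b where b: "l \<le> b" "b < k" "p = idx b" by auto
      have "\<bar>?P ! a\<bar> < \<bar>?P ! b\<bar>"
        using P1[OF a] t_le[OF a] P2[OF b(1,2)] b by simp
      moreover have "a < k" using a lk by simp
      ultimately have "\<bar>w ! idx a\<bar> < \<bar>w ! idx b\<bar>" using ord b by blast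
      then show "idx a < p \<and> \<bar>w ! idx a\<bar> < w ! p"
        using inc[of a b] pos'[OF b(1,2)] a b by simp
    qed
    ultimately show ?R by blast
  next
    assume ?R
    then obtain idx S where occ: "occurrence w t idx" and S: "decreasing_at w S" "card S = k - l"
      and NE: "\<forall>a<l. \<forall>p\<in>S. idx a < p \<and> \<bar>w ! idx a\<bar> < w ! p" by blast
    have mono: "strict_mono_on {..<l} idx" and lt: "\<forall>a<l. idx a < length w"
      and ord: "\<forall>a<l. \<forall>b<l. \<bar>w ! idx a\<bar> < \<bar>w ! idx b\<bar> \<longleftrightarrow> \<bar>t ! a\<bar> < \<bar>t ! b\<bar>"
      and pos: "\<forall>a<l. w ! idx a > 0 \<longleftrightarrow> t ! a > 0"
      using occ unfolding occurrence_def len by blast+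
    define e where "e = sorted_list_of_set S"
    have fin: "finite S" using S(1) by (rule decreasing_at_finite)
    have e: "length e = k - l" "sorted_wrt (<) e" "set e = S"
      using fin S(2) unfolding e_def by simp_all
    \<comment> \<open>The embedding of \<open>t\<close> is continued by the increasing enumeration
      of \<open>S\<close>, shifted by \<open>l\<close>.\<close>
    define j where "j a = (if a < l then idx a else e ! (a - l))" for a
    have jS: "j a \<in> S" if "l \<le> a" "a < k" for a
      using that e(1,3) nth_mem[of "a - l" e] unfolding j_def by auto
    have jpos: "w ! j a > 0" if "l \<le> a" "a < k" for a
      using jS[OF that] S(1) unfolding decreasing_at_def by blast
    have inc: "j a < j b" if "a < b" "b < k" for a b
    proof -
      consider "b < l" | "a < l" "l \<le> b" | "l \<le> a" "l \<le> b" using that by linarith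
      then show ?thesis
      proof cases
        case 1
        then show ?thesis using mono that unfolding j_def by (simp add: strict_mono_onD)
      next
        case 2
        then show ?thesis using NE jS[of b] that by (simp add: j_def)
      next
        case 3
        then show ?thesis
          using sorted_wrt_nth_less[OF e(2), of "a - l" "b - l"] that e(1) unfolding j_def by simp
      qed
    qed
    have dec: "w ! j b < w ! j a" if "l \<le> a" "a < b" "b < k" for a b
      using S(1) jS[of a] jS[of b] inc[OF that(2,3)] that unfolding decreasing_at_def by simp
    have "strict_mono_on {..<k} j"
      using inc by (auto simp: strict_mono_on_def)
    moreover have "\<forall>a<k. j a < length w"
    proof (intro allI impI)
      fix a assume "a < k"
      then show "j a < length w"
        using lt jS[of a] S(1) unfolding decreasing_at_def by (cases "a < l") (auto simp: j_def)
    qed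
    moreover have "\<forall>a<k. \<forall>b<k. \<bar>w ! j a\<bar> < \<bar>w ! j b\<bar> \<longleftrightarrow> \<bar>?P ! a\<bar> < \<bar>?P ! b\<bar>"
    proof (intro allI impI)
      fix a b assume a: "a < k" and b: "b < k"
      \<comment> \<open>Both strict inequalities hold for a pair in this order; for the reversed
        pair both sides of the equivalence are therefore false.\<close>
      have mixed: "\<bar>w ! j c\<bar> < \<bar>w ! j d\<bar> \<and> \<bar>?P ! c\<bar> < \<bar>?P ! d\<bar>" if "c < l" "l \<le> d" "d < k" for c d
      proof -
        have "\<bar>w ! idx c\<bar> < w ! j d" using NE that jS by blast
        then show ?thesis
          using that P1[OF that(1)] t_le[OF that(1)] P2[OF that(2,3)] by (simp add: j_def)
      qed
      consider "a < l" "b < l" | "a < l" "l \<le> b" | "l \<le> a" "b < l" | "l \<le> a" "l \<le> b"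
        by linarith
      then show "\<bar>w ! j a\<bar> < \<bar>w ! j b\<bar> \<longleftrightarrow> \<bar>?P ! a\<bar> < \<bar>?P ! b\<bar>"
      proof cases
        case 1
        then show ?thesis using ord P1 by (simp add: j_def)
      next
        case 2
        then show ?thesis using mixed b by blast
      next
        case 3
        then show ?thesis using mixed[of b a] a by linarith
      next
        case 4
        have "w ! j a < w ! j b \<longleftrightarrow> b < a"
          using dec[of a b] dec[of b a] 4 a b by (metis less_asym linorder_neqE_nat order_less_irrefl)
        then show ?thesis
          using jpos[of a] jpos[of b] P2[of a] P2[of b] 4 a b by auto
      qed
    qed
    moreover have "\<forall>a<k. w ! j a > 0 \<longleftrightarrow> ?P ! a > 0"
    proof (intro allI impI)
      fix a assume a: "a < k"
      show "w ! j a > 0 \<longleftrightarrow> ?P ! a > 0"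
      proof (cases "a < l")
        case True
        then show ?thesis using pos P1 by (simp add: j_def)
      next
        case False
        then show ?thesis using jpos[of a] P2[of a] a by simp
      qed
    qed
    ultimately show "contains w ?P" unfolding contains_def lenP by blast
  qed
qed

section \<open>The flip exchanges the two patterns\<close>

text \<open>The tail \<open>S\<close> itself shows that every entry matching \<open>t\<close> is
  low, so all these signs change. The tail is then replaced by one without low entries, which
  survives the flip.\<close>

lemma contains_flip_low:
  assumes w: "w \<in> signed_perms n" and t: "t \<in> signed_perms l" and lk: "l \<le> k"
    and cont: "contains w (t @ rev [int l + 1..int k])"
  shows "contains (flip_low (k - l) w) (bar t @ rev [int l + 1..int k])"
proof -
  let ?v = "flip_low (k - l) w"
  from cont obtain idx S where occ: "occurrence w t idx"
    and S: "decreasing_at w S" "card S = k - l"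
    and NE: "\<forall>a<l. \<forall>p\<in>S. idx a < p \<and> \<bar>w ! idx a\<bar> < w ! p"
    unfolding contains_append_decreasing_iff[OF t lk] by blast
  have len: "length t = l" "length w = n" using t w unfolding signed_perms_def by simp_all
  have lt: "idx a < n" if "a < l" for a
    using occ that unfolding occurrence_def len by blast
  have v: "?v ! idx a = - w ! idx a" if "a < l" for a
  proof -
    have "low (k - l) w (idx a)" unfolding low_def using S NE that by blast
    then show ?thesis using lt[OF that] len by (simp add: nth_flip_low)
  qed
  \<comment> \<open>One \<open>T\<close> serves all \<open>a < l\<close> simultaneously, because its
    last property holds for every cell \<open>(i, c)\<close>.\<close>
  obtain T where T: "decreasing_at w T" "card T = k - l" "\<And>p. p \<in> T \<Longrightarrow> \<not> low (k - l) w p"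
    "\<And>i c. (\<forall>p\<in>S. i < p \<and> c < w ! p) \<Longrightarrow> (\<forall>p\<in>T. i < p \<and> c < w ! p)"
    by (rule exists_decreasing_at_not_low[OF S(1,2)]) blast
  have eq: "?v ! p = w ! p" if "p \<in> T" for p
    using T(1,3) that unfolding decreasing_at_def by (auto simp: nth_flip_low)
  have "decreasing_at ?v T"
    by (rule decreasing_at_cong[OF T(1)]) (simp_all add: eq)
  moreover have "\<forall>a<l. \<forall>p\<in>T. idx a < p \<and> \<bar>?v ! idx a\<bar> < ?v ! p"
  proof (intro allI impI)
    fix a assume a: "a < l"
    then have "\<forall>p\<in>T. idx a < p \<and> \<bar>w ! idx a\<bar> < w ! p" using NE by (intro T(4)) blast
    then show "\<forall>p\<in>T. idx a < p \<and> \<bar>?v ! idx a\<bar> < ?v ! p" using eq v[OF a] by simp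
  qed
  moreover have "occurrence ?v (bar t) idx"
  proof -
    have "?v ! idx a > 0 \<longleftrightarrow> bar t ! a > 0" if a: "a < l" for a
    proof -
      have "w ! idx a > 0 \<longleftrightarrow> t ! a > 0" using occ a unfolding occurrence_def len by blast
      \<comment> \<open>Patterns compare only positivity; negation reverses it because no entry is
        zero.\<close>
      moreover have "w ! idx a \<noteq> 0" "t ! a \<noteq> 0"
        using signed_perms_nth(1)[OF w lt[OF a]] signed_perms_nth(1)[OF t a] by auto
      ultimately show ?thesis using v[OF a] a len by (auto simp: bar_def)
    qed
    then show ?thesis
      using occ v len unfolding occurrence_def by (simp add: bar_def)
  qed
  ultimately show ?thesis
    unfolding contains_append_decreasing_iff[OF bar_signed_perms[OF t] lk] using T(2) by blast
qed

text \<open>The converse is the same implication for \<open>flip_low (k - l) w\<close> and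
  \<open>bar t\<close>, as both operations are involutions.\<close>

lemma contains_flip_low_iff:
  assumes w: "w \<in> signed_perms n" and t: "t \<in> signed_perms l" and lk: "l \<le> k"
  shows "contains (flip_low (k - l) w) (bar t @ rev [int l + 1..int k]) \<longleftrightarrow>
    contains w (t @ rev [int l + 1..int k])"
proof
  have "bar (bar t) = t" by (simp add: bar_def comp_def)
  then show "contains w (t @ rev [int l + 1..int k])"
    if "contains (flip_low (k - l) w) (bar t @ rev [int l + 1..int k])"
    using contains_flip_low[OF flip_low_signed_perms[OF w] bar_signed_perms[OF t] lk that] by simp
qed (rule contains_flip_low[OF w t lk])

text \<open>Stated for any \<open>M\<close> closed under the flip, so that it applies to signed
  permutations and to signed involutions alike.\<close>

lemma card_avoiding_bar:
  assumes M: "M \<subseteq> signed_perms n" "\<And>w. w \<in> M \<Longrightarrow> flip_low (k - l) w \<in> M"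
    and t: "t \<in> signed_perms l" and lk: "l \<le> k"
  shows "card (avoiding M (t @ rev [int l + 1..int k])) =
    card (avoiding M (bar t @ rev [int l + 1..int k]))"
proof (rule bij_betw_same_card)
  show "bij_betw (flip_low (k - l)) (avoiding M (t @ rev [int l + 1..int k]))
      (avoiding M (bar t @ rev [int l + 1..int k]))"
  proof (rule bij_betw_byWitness[where f' = "flip_low (k - l)"])
    show "flip_low (k - l) ` avoiding M (t @ rev [int l + 1..int k])
        \<subseteq> avoiding M (bar t @ rev [int l + 1..int k])"
      using M contains_flip_low_iff[OF _ t lk] unfolding avoiding_def by blast
    show "flip_low (k - l) ` avoiding M (bar t @ rev [int l + 1..int k])
        \<subseteq> avoiding M (t @ rev [int l + 1..int k])"
    proof
      fix v assume "v \<in> flip_low (k - l) ` avoiding M (bar t @ rev [int l + 1..int k])"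
      then obtain w where w: "w \<in> M" "\<not> contains w (bar t @ rev [int l + 1..int k])"
        and v: "v = flip_low (k - l) w"
        unfolding avoiding_def by blast
      have vM: "v \<in> M" using M(2) w(1) v by blast
      then show "v \<in> avoiding M (t @ rev [int l + 1..int k])"
        \<comment> \<open>The equivalence is used at \<open>v\<close>, whose flip is
          \<open>w\<close>.\<close>
        using contains_flip_low_iff[of v n, OF _ t lk] M(1) w(2) v unfolding avoiding_def by auto
    qed
  qed simp_all
qed

theorem theorem2p3:
  fixes l k n :: nat and \<tau> P Q :: "int list"
  assumes "l \<le> k"
    and "\<tau> \<in> signed_perms l"
    and "P = \<tau> @ rev [int l + 1..int k]"
    and "Q = bar \<tau> @ rev [int l + 1..int k]"
    and "n \<ge> 1"
  shows "card (avoiding (signed_perms n) P) = card (avoiding (signed_perms n) Q) \<and>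
    card (avoiding (signed_involutions n) P) = card (avoiding (signed_involutions n) Q)"
proof
  show "card (avoiding (signed_perms n) P) = card (avoiding (signed_perms n) Q)"
    unfolding assms(3,4)
    by (rule card_avoiding_bar[OF subset_refl flip_low_signed_perms assms(2,1)])
  have "signed_involutions n \<subseteq> signed_perms n" unfolding signed_involutions_def by blast
  then show "card (avoiding (signed_involutions n) P) = card (avoiding (signed_involutions n) Q)"
    unfolding assms(3,4)
    by (rule card_avoiding_bar[OF _ flip_low_signed_involutions assms(2,1)])
qed

end
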